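(* Let $A$ be a set of regular cardinals with $\operatorname{ot}(A)<\mu:=\sup(A)$ such that every $a\in A$ carries a Jónsson algebra, and suppose $\mu^+\in\operatorname{spec}^*(A)$. Then $\mu^+$ carries a Jónsson algebra.
   Context: An algebra is a structure $\langle X,f_n\rangle_{n<\omega}$ where each $f_n$ is a finitary function from $X$ to $X$; a Jónsson algebra is an algebra with no proper subalgebra of the same cardinality; a cardinal $\lambda$ carries a Jónsson algebra if there is a Jónsson algebra of cardinality $\lambda$. For a set $A$ of regular cardinals, $\prod A$ is the set of functions on $A$ with $f(a)\in a$; for $\mathcal{G}\subseteq\prod A$, $\operatorname{ub}(\mathcal{G})$ is the set of $a\in A$ with $\{f(a):f\in\mathcal{G}\}$ unbounded in $a$. $\operatorname{spec}^*(A)$ is the set of regular $\lambda$ such that there is $\mathcal{F}\subseteq\prod A$ of size $\lambda$ such that for every $\mathcal{F}_0\subseteq\mathcal{F}$ of size $\lambda$, $\operatorname{ub}(\mathcal{F}_0)$ is unbounded in $\sup(A)$. $\operatorname{ot}(A)$ is the order type of $A$. *)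

theory Defs
  imports Main "HOL-Library.Equipollence" "HOL-Library.FuncSet"
begin

text \<open>Ordinals are modelled as elements of a well-ordered type 'u; the ordinal
  alpha is identified with its set of predecessors.\<close>

definition pred_set :: "'u::wellorder \<Rightarrow> 'u set" where
  "pred_set \<alpha> = {x. x < \<alpha>}"

definition is_cardinal :: "'u::wellorder \<Rightarrow> bool" where
  "is_cardinal \<alpha> \<longleftrightarrow> (\<forall>\<beta><\<alpha>. pred_set \<beta> \<prec> pred_set \<alpha>)"

definition unbounded_in :: "'u::wellorder set \<Rightarrow> 'u \<Rightarrow> bool" where
  "unbounded_in X \<alpha> \<longleftrightarrow> (\<forall>\<beta><\<alpha>. \<exists>x\<in>X. \<beta> \<le> x)"

definition regular_cardinal :: "'u::wellorder \<Rightarrow> bool" where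
  "regular_cardinal \<alpha> \<longleftrightarrow> is_cardinal \<alpha> \<and> infinite (pred_set \<alpha>) \<and>
     (\<forall>X. X \<subseteq> pred_set \<alpha> \<and> unbounded_in X \<alpha> \<longrightarrow> X \<approx> pred_set \<alpha>)"

definition is_sup :: "'u::wellorder set \<Rightarrow> 'u \<Rightarrow> bool" where
  "is_sup A \<mu> \<longleftrightarrow> (\<forall>a\<in>A. a \<le> \<mu>) \<and> (\<forall>b. (\<forall>a\<in>A. a \<le> b) \<longrightarrow> \<mu> \<le> b)"

definition order_type_is :: "'u::wellorder set \<Rightarrow> 'u \<Rightarrow> bool" where
  "order_type_is A \<gamma> \<longleftrightarrow> (\<exists>h. bij_betw h A (pred_set \<gamma>) \<and> strict_mono_on A h)"

definition ot_less :: "'u::wellorder set \<Rightarrow> 'u \<Rightarrow> bool" where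
  "ot_less A \<mu> \<longleftrightarrow> (\<exists>\<gamma><\<mu>. order_type_is A \<gamma>)"

definition succ_card :: "'u::wellorder \<Rightarrow> 'u \<Rightarrow> bool" where
  "succ_card \<mu> \<kappa> \<longleftrightarrow> pred_set \<mu> \<prec> pred_set \<kappa> \<and>
     (\<forall>\<beta><\<kappa>. \<not> pred_set \<mu> \<prec> pred_set \<beta>)"

definition is_algebra :: "'b set \<Rightarrow> (nat \<Rightarrow> nat) \<Rightarrow> (nat \<Rightarrow> 'b list \<Rightarrow> 'b) \<Rightarrow> bool" where
  "is_algebra X ar f \<longleftrightarrow>
     (\<forall>n xs. length xs = ar n \<and> set xs \<subseteq> X \<longrightarrow> f n xs \<in> X)"

definition is_subalgebra :: "'b set \<Rightarrow> 'b set \<Rightarrow> (nat \<Rightarrow> nat) \<Rightarrow> (nat \<Rightarrow> 'b list \<Rightarrow> 'b) \<Rightarrow> bool" where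
  "is_subalgebra Y X ar f \<longleftrightarrow> Y \<subseteq> X \<and>
     (\<forall>n xs. length xs = ar n \<and> set xs \<subseteq> Y \<longrightarrow> f n xs \<in> Y)"

definition jonsson_algebra :: "'b set \<Rightarrow> (nat \<Rightarrow> nat) \<Rightarrow> (nat \<Rightarrow> 'b list \<Rightarrow> 'b) \<Rightarrow> bool" where
  "jonsson_algebra X ar f \<longleftrightarrow> is_algebra X ar f \<and>
     (\<forall>Y. is_subalgebra Y X ar f \<and> Y \<approx> X \<longrightarrow> Y = X)"

definition carries_jonsson :: "'u::wellorder \<Rightarrow> bool" where
  "carries_jonsson lam \<longleftrightarrow> (\<exists>ar f. jonsson_algebra (pred_set lam) ar f)"

definition prod_card :: "'u::wellorder set \<Rightarrow> ('u \<Rightarrow> 'u) set" where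
  "prod_card A = (\<Pi>\<^sub>E a\<in>A. pred_set a)"

definition ub :: "'u::wellorder set \<Rightarrow> ('u \<Rightarrow> 'u) set \<Rightarrow> 'u set" where
  "ub A G = {a\<in>A. unbounded_in ((\<lambda>f. f a) ` G) a}"

definition in_spec_star :: "'u::wellorder \<Rightarrow> 'u set \<Rightarrow> 'u \<Rightarrow> bool" where
  "in_spec_star lam A \<mu> \<longleftrightarrow> regular_cardinal lam \<and>
     (\<exists>F \<subseteq> prod_card A. F \<approx> pred_set lam \<and>
        (\<forall>F0 \<subseteq> F. F0 \<approx> pred_set lam \<longrightarrow> unbounded_in (ub A F0) \<mu>))"

end

theory Submission
  imports Defs "HOL-Library.Countable_Set"
begin

text \<open>Fix an infinite \<open>\<theta> < \<mu>\<close> with \<open>\<theta> \<ge> ot(A)\<close> and some \<open>a\<^sub>0 \<in> A\<close> above \<open>\<theta>\<close>. Consider countably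
  many operations on \<open>\<kappa> = \<mu>\<^sup>+\<close>: evaluation of an enumeration of the witness \<open>F\<close> of
  \<open>\<mu>\<^sup>+ \<in> spec*(A)\<close> at the \<open>\<xi>\<close>-th element of \<open>A\<close>, the Jonsson operations of the \<open>\<xi>\<close>-th element
  of \<open>A\<close>, and surjections from \<open>\<mu>\<close> onto each \<open>\<alpha> < \<kappa>\<close>. If \<open>N\<close> has size \<open>\<kappa>\<close>, is closed under these
  and contains \<open>ot(A)\<close>, then \<open>N\<close> is unbounded in cofinally many \<open>a \<in> A\<close>, hence contains
  them, hence contains \<open>\<mu>\<close> and finally \<open>\<kappa>\<close>.

  To dispense with the assumption \<open>ot(A) \<subseteq> N\<close>, add the Jonsson operations of \<open>a\<^sub>0\<close> and the operation
  that sends \<open>x\<^sub>1,\<dots>,x\<^sub>n\<close> to a bound below \<open>a\<^sub>0\<close> of the part below \<open>a\<^sub>0\<close> of the closure of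
  \<open>{x\<^sub>1,\<dots>,x\<^sub>n} \<union> \<theta>\<close>; it exists because \<open>a\<^sub>0\<close> is regular and this closure has size at most
  \<open>|\<theta>| < a\<^sub>0\<close>. If \<open>M\<close> of size \<open>\<kappa>\<close> is closed under all operations, the closure of \<open>M \<union> \<theta>\<close> contains
  \<open>a\<^sub>0\<close> by the first part, so \<open>M\<close> is unbounded in \<open>a\<^sub>0\<close>, so \<open>a\<^sub>0 \<subseteq> M\<close>, so \<open>ot(A) \<subseteq> M\<close>, and
  the first part applies to \<open>M\<close> itself.\<close>

section \<open>Cardinal arithmetic below an infinite set\<close>

lemma lepoll_iff_ordLeq: "A \<lesssim> B \<longleftrightarrow> (card_of A, card_of B) \<in> ordLeq"
  unfolding lepoll_def by (rule card_of_ordLeq)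

lemma lepoll_total: "A \<lesssim> B \<or> B \<lesssim> A"
  unfolding lepoll_iff_ordLeq
  by (meson card_of_Well_order ordLeq_total)

lemma not_lesspoll_imp_lepoll: "\<not> A \<prec> B \<Longrightarrow> B \<lesssim> A"
  using lepoll_total[of A B] eqpoll_imp_lepoll eqpoll_sym by (auto simp: lepoll_iff_leqpoll)

lemma UN_lepoll_infinite:
  assumes "infinite B" "I \<lesssim> B" "\<And>i. i \<in> I \<Longrightarrow> X i \<lesssim> B"
  shows "(\<Union>i\<in>I. X i) \<lesssim> B"
  using assms card_of_UNION_ordLeq_infinite[of B I X] by (simp add: lepoll_iff_ordLeq)

lemma Times_lepoll_infinite:
  assumes "infinite B" "X \<lesssim> B" "Y \<lesssim> B"
  shows "X \<times> Y \<lesssim> B"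
proof -
  have "X \<times> Y = (\<Union>x\<in>X. Pair x ` Y)"
    by auto
  then show ?thesis
    using UN_lepoll_infinite[OF assms(1,2), of "\<lambda>x. Pair x ` Y"] image_lepoll lepoll_trans assms(3)
    by metis
qed

lemma Un_lepoll_infinite:
  assumes "infinite B" "X \<lesssim> B" "Y \<lesssim> B"
  shows "X \<union> Y \<lesssim> B"
  using UN_lepoll_infinite[of B "{X, Y}" "\<lambda>Z. Z"] assms finite_lepoll_infinite[of B "{X, Y}"]
  by auto

lemma countable_lepoll_infinite:
  assumes "infinite B" "countable X"
  shows "X \<lesssim> B"
proof -
  have "X \<lesssim> (UNIV :: nat set)"
    using assms(2) unfolding countable_def lepoll_def by blast
  then show ?thesis
    using assms(1) infinite_le_lepoll lepoll_trans by blast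
qed

text \<open>By induction there are at most |\<open>B\<close>| lists of each length, and there are
  only countably many lengths.\<close>

lemma lists_lepoll_infinite:
  assumes "infinite B" "X \<lesssim> B"
  shows "lists X \<lesssim> B"
proof -
  have len: "{xs \<in> lists X. length xs = n} \<lesssim> B" for n
  proof (induction n)
    case 0
    have "{xs \<in> lists X. length xs = 0} = {[]}"
      by auto
    then show ?case
      using assms(1) finite_lepoll_infinite[of B "{[]}"] by simp
  next
    case (Suc n)
    have "{xs \<in> lists X. length xs = Suc n}
        \<subseteq> (\<lambda>(x, xs). x # xs) ` (X \<times> {xs \<in> lists X. length xs = n})"
      by (auto simp: length_Suc_conv image_iff)
    then show ?case
      by (rule lepoll_trans[OF subset_image_lepoll Times_lepoll_infinite[OF assms Suc]])
  qed
  have eq: "lists X = (\<Union>n\<in>UNIV. {xs \<in> lists X. length xs = n})"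
    by blast
  show ?thesis
    using assms(1) infinite_le_lepoll by (subst eq, intro UN_lepoll_infinite len) auto
qed

section \<open>Closures under countably many operations\<close>

text \<open>Operations take lists of arbitrary length, so one function stands for
  countably many finitary operations, one for each arity.\<close>

definition closed_under :: "('b list \<Rightarrow> 'b) set \<Rightarrow> 'b set \<Rightarrow> bool" where
  "closed_under C Y \<longleftrightarrow> (\<forall>f\<in>C. \<forall>xs. set xs \<subseteq> Y \<longrightarrow> f xs \<in> Y)"

lemma closed_underD: "closed_under C Y \<Longrightarrow> f \<in> C \<Longrightarrow> set xs \<subseteq> Y \<Longrightarrow> f xs \<in> Y"
  by (auto simp: closed_under_def)

definition op_closure :: "('b list \<Rightarrow> 'b) set \<Rightarrow> 'b set \<Rightarrow> 'b set" where
  "op_closure C Z = \<Inter>{Y. Z \<subseteq> Y \<and> closed_under C Y}"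

lemma op_closure_superset: "Z \<subseteq> op_closure C Z"
  by (auto simp: op_closure_def)

lemma op_closure_least: "Z \<subseteq> Y \<Longrightarrow> closed_under C Y \<Longrightarrow> op_closure C Z \<subseteq> Y"
  by (auto simp: op_closure_def)

lemma closed_under_op_closure: "closed_under C (op_closure C Z)"
  unfolding closed_under_def op_closure_def by blast

lemma op_closure_mono: "Z \<subseteq> Z' \<Longrightarrow> op_closure C Z \<subseteq> op_closure C Z'"
  by (auto simp: op_closure_def)

text \<open>The closure lies in the union of countably many stages, each adding the values of the
  operations on lists from the stage before; no stage exceeds \<open>B\<close> in size.\<close>

lemma op_closure_lepoll:
  assumes "infinite B" "countable C" "Z \<lesssim> B"
  shows "op_closure C Z \<lesssim> B"
proof -
  define st where "st = rec_nat Z (\<lambda>_ S. S \<union> (\<lambda>(f, xs). f xs) ` (C \<times> lists S))"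
  have st_0: "st 0 = Z"
    and st_Suc: "st (Suc n) = st n \<union> (\<lambda>(f, xs). f xs) ` (C \<times> lists (st n))" for n
    by (simp_all add: st_def)
  have st_lepoll: "st n \<lesssim> B" for n
  proof (induction n)
    case 0
    then show ?case by (simp add: st_0 assms)
  next
    case (Suc n)
    have "C \<times> lists (st n) \<lesssim> B"
      using Times_lepoll_infinite lists_lepoll_infinite countable_lepoll_infinite Suc assms by metis
    then show ?case
      unfolding st_Suc using Un_lepoll_infinite[OF assms(1) Suc] image_lepoll lepoll_trans by blast
  qed
  have st_mono: "m \<le> n \<Longrightarrow> st m \<subseteq> st n" for m n
    by (rule lift_Suc_mono_le) (auto simp: st_Suc)
  \<comment> \<open>A list has finitely many entries and the stages increase, so a single stage
    contains them all.\<close>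
  have in_stage: "\<exists>n. set xs \<subseteq> st n" if "set xs \<subseteq> (\<Union>n. st n)" for xs
    using that
  proof (induction xs)
    case (Cons x xs)
    then obtain m n where "x \<in> st m" "set xs \<subseteq> st n"
      by auto
    then have "set (x # xs) \<subseteq> st (max m n)"
      using st_mono[of m "max m n"] st_mono[of n "max m n"] by auto
    then show ?case ..
  qed auto
  have "closed_under C (\<Union>n. st n)"
    unfolding closed_under_def
  proof (intro ballI allI impI)
    fix f xs assume "f \<in> C" "set xs \<subseteq> (\<Union>n. st n)"
    then obtain n where "set xs \<subseteq> st n"
      using in_stage by blast
    then have "f xs \<in> st (Suc n)"
      using \<open>f \<in> C\<close> unfolding st_Suc by (force simp: image_iff)
    then show "f xs \<in> (\<Union>n. st n)"
      by blast
  qed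
  then have "op_closure C Z \<subseteq> (\<Union>n. st n)"
    using st_0 by (intro op_closure_least) auto
  moreover have "(\<Union>n. st n) \<lesssim> B"
    using assms(1) infinite_le_lepoll by (intro UN_lepoll_infinite st_lepoll) auto
  ultimately show ?thesis
    using subset_imp_lepoll lepoll_trans by blast
qed

text \<open>The points with a finite support in \<open>M\<close> contain \<open>M \<union> T\<close>
  and are closed under \<open>C\<close>, because finitely many supports can be concatenated.
  \<open>T\<close> is kept whole throughout.\<close>

lemma op_closure_finitary:
  assumes "y \<in> op_closure C (M \<union> T)"
  shows "\<exists>xs. set xs \<subseteq> M \<and> y \<in> op_closure C (set xs \<union> T)"
proof -
  let ?Y = "{y. \<exists>xs. set xs \<subseteq> M \<and> y \<in> op_closure C (set xs \<union> T)}"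
  have support: "\<exists>xs. set xs \<subseteq> M \<and> set ys \<subseteq> op_closure C (set xs \<union> T)"
    if "set ys \<subseteq> ?Y" for ys
    using that
  proof (induction ys)
    case (Cons y ys)
    then obtain xs zs where "set xs \<subseteq> M" "set ys \<subseteq> op_closure C (set xs \<union> T)"
      "set zs \<subseteq> M" "y \<in> op_closure C (set zs \<union> T)"
      by auto
    moreover have "op_closure C (set xs \<union> T) \<subseteq> op_closure C (set (xs @ zs) \<union> T)"
      "op_closure C (set zs \<union> T) \<subseteq> op_closure C (set (xs @ zs) \<union> T)"
      by (auto intro!: op_closure_mono)
    ultimately show ?case
      by (intro exI[of _ "xs @ zs"]) auto
  qed (auto intro: exI[of _ "[]"])
  have "closed_under C ?Y"
    unfolding closed_under_def
  proof (intro ballI allI impI)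
    fix f ys assume "f \<in> C" "set ys \<subseteq> ?Y"
    then show "f ys \<in> ?Y"
      using support[of ys] closed_underD[OF closed_under_op_closure] by blast
  qed
  moreover have "M \<union> T \<subseteq> ?Y"
  proof
    fix z assume "z \<in> M \<union> T"
    then show "z \<in> ?Y"
    proof
      assume "z \<in> M"
      then have "set [z] \<subseteq> M" "z \<in> op_closure C (set [z] \<union> T)"
        using op_closure_superset[of "set [z] \<union> T" C] by auto
      then show ?thesis by blast
    next
      assume "z \<in> T"
      then have "set [] \<subseteq> M" "z \<in> op_closure C (set [] \<union> T)"
        using op_closure_superset[of "set [] \<union> T" C] by auto
      then show ?thesis by blast
    qed
  qed
  ultimately show ?thesis
    using assms op_closure_least by blast
qed

text \<open>\<open>carries_jonsson\<close> asks for a sequence of operations of fixed arity, so each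
  pair of an operation in \<open>C\<close> and an arity is coded by one natural number.\<close>

lemma carries_jonssonI:
  assumes "countable C" "closed_under C (pred_set lam)"
    and "\<And>Y. Y \<subseteq> pred_set lam \<Longrightarrow> closed_under C Y \<Longrightarrow> Y \<approx> pred_set lam \<Longrightarrow> Y = pred_set lam"
  shows "carries_jonsson lam"
proof (cases "C = {}")
  case True
  \<comment> \<open>With nothing to enumerate, the unary identity is used; every subset is closed
    under it, as under the empty \<open>C\<close>.\<close>
  have "is_algebra (pred_set lam) (\<lambda>_. 1) (\<lambda>_. hd)"
    unfolding is_algebra_def by (metis hd_in_set length_0_conv one_neq_zero subsetD)
  moreover have "Y = pred_set lam" if "Y \<subseteq> pred_set lam" "Y \<approx> pred_set lam" for Y
    using assms(3) that True by (simp add: closed_under_def)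
  ultimately show ?thesis
    unfolding carries_jonsson_def jonsson_algebra_def is_subalgebra_def by blast
next
  case False
  define ar :: "nat \<Rightarrow> nat" where "ar n = snd (prod_decode n)" for n
  define f where "f n = from_nat_into C (fst (prod_decode n))" for n
  have f_in: "f n \<in> C" for n
    by (simp add: f_def from_nat_into False)
  have "closed_under C Y" if "is_subalgebra Y (pred_set lam) ar f" for Y
    unfolding closed_under_def
  proof (intro ballI allI impI)
    fix g xs assume "g \<in> C" "set xs \<subseteq> Y"
    define n where "n = prod_encode (to_nat_on C g, length xs)"
    have "f n = g" "ar n = length xs"
      using \<open>g \<in> C\<close> assms(1) by (simp_all add: f_def ar_def n_def)
    then show "g xs \<in> Y"
      using that \<open>set xs \<subseteq> Y\<close> unfolding is_subalgebra_def by metis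
  qed
  then have "jonsson_algebra (pred_set lam) ar f"
    using assms(2,3) f_in unfolding jonsson_algebra_def is_algebra_def is_subalgebra_def
    by (meson closed_underD)
  then show ?thesis
    unfolding carries_jonsson_def by blast
qed

section \<open>Unbounded subsets of cardinals\<close>

lemma unbounded_in_mono: "unbounded_in X \<alpha> \<Longrightarrow> X \<subseteq> Y \<Longrightarrow> unbounded_in Y \<alpha>"
  unfolding unbounded_in_def by (meson subsetD)

lemma regular_cardinal_bounded:
  assumes "regular_cardinal a" "X \<subseteq> pred_set a" "X \<prec> pred_set a"
  shows "\<exists>\<beta><a. \<forall>x\<in>X. x < \<beta>"
proof -
  have "\<not> X \<approx> pred_set a"
    using assms(3) by (simp add: lesspoll_def)
  then have "\<not> unbounded_in X a"
    using assms(1,2) unfolding regular_cardinal_def by blast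
  then show ?thesis
    unfolding unbounded_in_def by (meson not_le)
qed

text \<open>Otherwise \<open>a\<close> would be \<beta> with one point added, which for an infinite
  set does not change the size.\<close>

lemma infinite_cardinal_limit:
  assumes "is_cardinal a" "infinite (pred_set a)" "\<beta> < a"
  shows "\<exists>\<beta>'. \<beta> < \<beta>' \<and> \<beta>' < a"
proof (rule ccontr)
  assume "\<not> ?thesis"
  then have eq: "pred_set a = insert \<beta> (pred_set \<beta>)"
    using assms(3) by (auto simp: pred_set_def not_less intro: le_neq_trans)
  then have "pred_set a \<approx> pred_set \<beta>"
    using assms(2) infinite_insert_eqpoll by (metis finite_insert)
  then show False
    using assms(1,3) eqpoll_sym unfolding is_cardinal_def lesspoll_def by blast
qed

lemma eqpoll_cardinal_unbounded:
  assumes "is_cardinal lam" "Y \<approx> pred_set lam" "\<beta> < lam"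
  shows "\<exists>y\<in>Y. \<beta> \<le> y"
proof (rule ccontr)
  assume "\<not> ?thesis"
  then have "Y \<subseteq> pred_set \<beta>"
    by (auto simp: pred_set_def)
  then have "pred_set lam \<lesssim> pred_set \<beta>"
    using assms(2) subset_imp_lepoll lepoll_trans1 eqpoll_sym by blast
  moreover have "pred_set \<beta> \<prec> pred_set lam"
    using assms(1,3) by (simp add: is_cardinal_def)
  ultimately show False
    using lesspoll_trans1 lesspoll_not_refl by blast
qed

text \<open>Regularity turns unboundedness into full cardinality, so the trace of \<open>N\<close>
  on \<open>a\<close> is a subalgebra of full size.\<close>

lemma jonsson_unbounded_subset:
  assumes "regular_cardinal a" "jonsson_algebra (pred_set a) ar j"
    and "unbounded_in (N \<inter> pred_set a) a"
    and "\<And>n xs. length xs = ar n \<Longrightarrow> set xs \<subseteq> N \<inter> pred_set a \<Longrightarrow> j n xs \<in> N"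
  shows "pred_set a \<subseteq> N"
proof -
  have "N \<inter> pred_set a \<approx> pred_set a"
    using assms(1,3) by (simp add: regular_cardinal_def)
  moreover have "is_subalgebra (N \<inter> pred_set a) (pred_set a) ar j"
    using assms(2,4) by (auto simp: is_subalgebra_def jonsson_algebra_def is_algebra_def)
  ultimately show ?thesis
    using assms(2) unfolding jonsson_algebra_def by blast
qed

theorem theorem5p10:
  fixes A :: "'u::wellorder set" and \<mu> \<kappa> :: 'u
  assumes "\<forall>a\<in>A. regular_cardinal a"
    and "is_sup A \<mu>"
    and "ot_less A \<mu>"
    and "\<forall>a\<in>A. carries_jonsson a"
    and "succ_card \<mu> \<kappa>"
    and "in_spec_star \<kappa> A \<mu>"
  shows "carries_jonsson \<kappa>"
proof -
  have A_le: "a \<le> \<mu>" if "a \<in> A" for a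
    using assms(2) that by (simp add: is_sup_def)
  have A_cofinal: "\<exists>a\<in>A. \<beta> < a" if "\<beta> < \<mu>" for \<beta>
    using assms(2) that unfolding is_sup_def by (meson not_le)
  have A_infinite: "is_cardinal a" "infinite (pred_set a)" if "a \<in> A" for a
    using assms(1) that by (simp_all add: regular_cardinal_def)
  have \<mu>_less: "pred_set \<mu> \<prec> pred_set \<kappa>"
    using assms(5) by (simp add: succ_card_def)
  have "\<mu> < \<kappa>"
  proof (rule ccontr)
    assume "\<not> \<mu> < \<kappa>"
    then have "pred_set \<kappa> \<subseteq> pred_set \<mu>"
      by (auto simp: pred_set_def)
    then show False
      using \<mu>_less subset_imp_lepoll lesspoll_trans1 lesspoll_not_refl by blast
  qed
  have below_\<kappa>: "pred_set \<beta> \<lesssim> pred_set \<mu>" if "\<beta> < \<kappa>" for \<beta>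
    using assms(5) that not_lesspoll_imp_lepoll unfolding succ_card_def by blast
  have \<kappa>_card: "is_cardinal \<kappa>"
    using assms(6) by (simp add: in_spec_star_def regular_cardinal_def)

  \<comment> \<open>The witness family and the indexing of \<open>A\<close>\<close>
  obtain F where F: "F \<subseteq> prod_card A" "F \<approx> pred_set \<kappa>"
    and F_ub: "\<And>F0. F0 \<subseteq> F \<Longrightarrow> F0 \<approx> pred_set \<kappa> \<Longrightarrow> unbounded_in (ub A F0) \<mu>"
    using assms(6) unfolding in_spec_star_def by blast
  obtain \<phi> where \<phi>: "bij_betw \<phi> (pred_set \<kappa>) F"
    using F(2) eqpoll_sym unfolding eqpoll_def by blast
  have \<phi>_less: "\<phi> \<alpha> a < a" if "\<alpha> < \<kappa>" "a \<in> A" for \<alpha> a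
  proof -
    have "\<phi> \<alpha> \<in> prod_card A"
      using \<phi> F(1) that(1) by (auto simp: bij_betw_def pred_set_def)
    then show ?thesis
      using that(2) by (auto simp: prod_card_def pred_set_def)
  qed

  obtain \<gamma> h where "\<gamma> < \<mu>" and h: "bij_betw h A (pred_set \<gamma>)"
    using assms(3) unfolding ot_less_def order_type_is_def by blast
  define e where "e = inv_into A h"
  have e: "bij_betw e (pred_set \<gamma>) A"
    unfolding e_def using h by (rule bij_betw_inv_into)
  have e_in: "e \<xi> \<in> A" if "\<xi> < \<gamma>" for \<xi>
    using e that by (auto simp: bij_betw_def pred_set_def)

  \<comment> \<open>The supremum may be attained, so \<open>A = {\<mu>}\<close> has to be excluded:
    the product would then have size only \<mu>, too small for \<open>F\<close>.\<close>
  have "\<exists>a\<in>A. a \<noteq> \<mu>"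
  proof (rule ccontr)
    assume "\<not> ?thesis"
    then have "A = {\<mu>}"
      using A_cofinal[OF \<open>\<gamma> < \<mu>\<close>] by auto
    then have "prod_card A = ({\<mu>} \<rightarrow>\<^sub>E pred_set \<mu>)"
      by (auto simp: prod_card_def PiE_iff)
    then have "prod_card A \<approx> pred_set \<mu>"
      by (simp add: PiE_sing_eqpoll_self)
    then have "F \<lesssim> pred_set \<mu>"
      using F(1) subset_imp_lepoll lepoll_trans2 by blast
    then have "pred_set \<kappa> \<lesssim> pred_set \<mu>"
      using F(2) eqpoll_sym lepoll_trans1 by blast
    then show False
      using \<mu>_less lesspoll_trans1 lesspoll_not_refl by blast
  qed
  then obtain a1 where a1: "a1 \<in> A" "a1 < \<mu>"
    using A_le by (auto intro: le_neq_trans)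
  \<comment> \<open>Taking the maximum with \<open>a1\<close> makes \<theta> infinite, as the size
    bound for closures requires.\<close>
  define \<theta> where "\<theta> = max \<gamma> a1"
  have "\<theta> < \<mu>" "\<gamma> \<le> \<theta>"
    using \<open>\<gamma> < \<mu>\<close> a1 by (simp_all add: \<theta>_def)
  have "pred_set a1 \<subseteq> pred_set \<theta>"
    by (auto simp: \<theta>_def pred_set_def less_max_iff_disj)
  then have \<theta>_inf: "infinite (pred_set \<theta>)"
    using A_infinite(2)[OF a1(1)] finite_subset by blast
  obtain a0 where a0: "a0 \<in> A" "\<theta> < a0"
    using A_cofinal[OF \<open>\<theta> < \<mu>\<close>] by blast

  \<comment> \<open>The operations on \<kappa>\<close>
  have "\<forall>a. \<exists>ar j. a \<in> A \<longrightarrow> jonsson_algebra (pred_set a) ar j"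
    using assms(4) unfolding carries_jonsson_def by blast
  then obtain ar j where jon: "\<And>a. a \<in> A \<Longrightarrow> jonsson_algebra (pred_set a) (ar a) (j a)"
    by metis
  have j_less: "j a n xs < a" if "a \<in> A" "length xs = ar a n" "set xs \<subseteq> pred_set a" for a n xs
    using jon[OF that(1)] that(2,3) by (auto simp: jonsson_algebra_def is_algebra_def pred_set_def)
  have "\<forall>\<beta>. \<exists>g. \<beta> < \<kappa> \<longrightarrow> pred_set \<beta> \<subseteq> g ` pred_set \<mu>"
    using below_\<kappa> unfolding lepoll_iff by blast
  then obtain b where b: "\<And>\<beta>. \<beta> < \<kappa> \<Longrightarrow> pred_set \<beta> \<subseteq> b \<beta> ` pred_set \<mu>"
    by metis

  \<comment> \<open>\<open>\<mu>\<close> serves as the value of the operations outside their intended domains.\<close>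
  define ev where "ev zs = (if length zs = 2 \<and> zs ! 0 < \<kappa> \<and> zs ! 1 < \<gamma>
      then \<phi> (zs ! 0) (e (zs ! 1)) else \<mu>)" for zs
  define cov where "cov zs = (if b (zs ! 0) (zs ! 1) < \<kappa> then b (zs ! 0) (zs ! 1) else \<mu>)" for zs
  define jop where "jop a n xs = (if length xs = ar a n \<and> set xs \<subseteq> pred_set a
      then j a n xs else \<mu>)" for a n xs
  \<comment> \<open>The element of \<open>A\<close> enters through its index, passed as first
    argument; this keeps the operations countable in number even if \<open>A\<close> is
    uncountable.\<close>
  define jops where "jops n zs = (if zs \<noteq> [] \<and> hd zs < \<gamma> then jop (e (hd zs)) n (tl zs) else \<mu>)"
    for n zs
  define C where "C = {ev, cov} \<union> range jops"
  have C_countable: "countable C"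
    by (simp add: C_def)
  have jop_less: "jop a n xs < \<kappa>" if "a \<in> A" for a n xs
    using j_less[OF that, of xs n] A_le[OF that] \<open>\<mu> < \<kappa>\<close> by (auto simp: jop_def)
  have C_closed: "closed_under C (pred_set \<kappa>)"
  proof -
    have "ev zs < \<kappa>" for zs
      using \<phi>_less[of "zs ! 0" "e (zs ! 1)"] e_in[of "zs ! 1"] A_le[of "e (zs ! 1)"] \<open>\<mu> < \<kappa>\<close>
      by (auto simp: ev_def)
    moreover have "cov zs < \<kappa>" for zs
      using \<open>\<mu> < \<kappa>\<close> by (simp add: cov_def)
    moreover have "jops n zs < \<kappa>" for n zs
      using jop_less e_in \<open>\<mu> < \<kappa>\<close> by (simp add: jops_def)
    ultimately show ?thesis
      by (auto simp: closed_under_def C_def pred_set_def)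
  qed

  \<comment> \<open>Closed sets that contain all indices of \<open>A\<close>\<close>
  have contains_\<mu>: "pred_set \<mu> \<subseteq> N"
    if N: "N \<subseteq> pred_set \<kappa>" "N \<approx> pred_set \<kappa>" "closed_under C N" "pred_set \<gamma> \<subseteq> N" for N
  proof
    fix \<beta> assume "\<beta> \<in> pred_set \<mu>"
    then obtain a' where a': "a' \<in> A" "\<beta> < a'"
      using A_cofinal by (auto simp: pred_set_def)
    \<comment> \<open>Unboundedness in \<mu> yields only a weak inequality; starting from
      \<open>\<beta>'\<close> gives an \<open>a\<close> strictly above \<beta>.\<close>
    then obtain \<beta>' where "\<beta> < \<beta>'" "\<beta>' < a'"
      using infinite_cardinal_limit A_infinite by blast
    then have "\<beta>' < \<mu>"
      using A_le[OF a'(1)] by simp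
    have "inj_on \<phi> N"
      using \<phi> N(1) by (auto simp: bij_betw_def intro: inj_on_subset)
    then have "\<phi> ` N \<approx> pred_set \<kappa>"
      using N(2) inj_on_image_eqpoll_self eqpoll_trans by blast
    moreover have "\<phi> ` N \<subseteq> F"
      using \<phi> N(1) by (auto simp: bij_betw_def)
    ultimately have "unbounded_in (ub A (\<phi> ` N)) \<mu>"
      by (intro F_ub)
    then obtain a where "a \<in> ub A (\<phi> ` N)" "\<beta>' \<le> a"
      using \<open>\<beta>' < \<mu>\<close> unfolding unbounded_in_def by blast
    then have "a \<in> A" and unb: "unbounded_in ((\<lambda>f. f a) ` \<phi> ` N) a"
      by (auto simp: ub_def)
    obtain \<xi> where "\<xi> < \<gamma>" "e \<xi> = a"
      using e \<open>a \<in> A\<close> by (auto simp: bij_betw_def pred_set_def)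
    then have "\<xi> \<in> N"
      using N(4) by (auto simp: pred_set_def)
    have "\<phi> \<alpha> a \<in> N \<inter> pred_set a" if "\<alpha> \<in> N" for \<alpha>
    proof -
      have "\<alpha> < \<kappa>"
        using N(1) that by (auto simp: pred_set_def)
      then have "ev [\<alpha>, \<xi>] = \<phi> \<alpha> a"
        using \<open>\<xi> < \<gamma>\<close> \<open>e \<xi> = a\<close> by (simp add: ev_def)
      moreover have "ev [\<alpha>, \<xi>] \<in> N"
        using that \<open>\<xi> \<in> N\<close> by (intro closed_underD[OF N(3)]) (auto simp: C_def)
      ultimately show ?thesis
        using \<phi>_less[OF \<open>\<alpha> < \<kappa>\<close> \<open>a \<in> A\<close>] by (simp add: pred_set_def)
    qed
    then have "(\<lambda>f. f a) ` \<phi> ` N \<subseteq> N \<inter> pred_set a"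
      by auto
    with unb have unbN: "unbounded_in (N \<inter> pred_set a) a"
      by (rule unbounded_in_mono)
    have jN: "j a n xs \<in> N" if "length xs = ar a n" "set xs \<subseteq> N \<inter> pred_set a" for n xs
    proof -
      have "jops n (\<xi> # xs) = j a n xs"
        using that \<open>\<xi> < \<gamma>\<close> \<open>e \<xi> = a\<close> by (simp add: jops_def jop_def)
      moreover have "jops n (\<xi> # xs) \<in> N"
        using that \<open>\<xi> \<in> N\<close> by (intro closed_underD[OF N(3)]) (auto simp: C_def)
      ultimately show ?thesis by simp
    qed
    have "regular_cardinal a"
      using assms(1) \<open>a \<in> A\<close> by simp
    then have "pred_set a \<subseteq> N"
      using jon[OF \<open>a \<in> A\<close>] unbN jN by (rule jonsson_unbounded_subset)
    then show "\<beta> \<in> N"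
      using \<open>\<beta> < \<beta>'\<close> \<open>\<beta>' \<le> a\<close> by (auto simp: pred_set_def)
  qed

  \<comment> \<open>By its size \<open>N\<close> is cofinal in \<kappa>. For each \<alpha> in
    \<open>N\<close>, \<open>cov\<close> enumerates everything below \<alpha> from arguments below
    \<mu>, which lie in \<open>N\<close>.\<close>
  have contains_\<kappa>: "N = pred_set \<kappa>"
    if N: "N \<subseteq> pred_set \<kappa>" "N \<approx> pred_set \<kappa>" "closed_under C N" "pred_set \<gamma> \<subseteq> N" for N
  proof
    show "pred_set \<kappa> \<subseteq> N"
    proof
      fix \<beta> assume "\<beta> \<in> pred_set \<kappa>"
      then obtain \<alpha> where "\<alpha> \<in> N" "\<beta> \<le> \<alpha>"
        using eqpoll_cardinal_unbounded[OF \<kappa>_card N(2)] by (auto simp: pred_set_def)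
      show "\<beta> \<in> N"
      proof (cases "\<beta> = \<alpha>")
        case False
        then have "\<beta> \<in> pred_set \<alpha>" "\<alpha> < \<kappa>"
          using \<open>\<beta> \<le> \<alpha>\<close> \<open>\<alpha> \<in> N\<close> N(1) by (auto simp: pred_set_def)
        then obtain i where "i < \<mu>" "\<beta> = b \<alpha> i"
          using b[of \<alpha>] by (auto simp: pred_set_def)
        then have "cov [\<alpha>, i] = \<beta>"
          using \<open>\<beta> \<in> pred_set \<kappa>\<close> by (simp add: cov_def pred_set_def)
        moreover have "i \<in> N"
          using contains_\<mu>[OF N] \<open>i < \<mu>\<close> by (auto simp: pred_set_def)
        then have "cov [\<alpha>, i] \<in> N"
          using \<open>\<alpha> \<in> N\<close> by (intro closed_underD[OF N(3)]) (auto simp: C_def)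
        ultimately show ?thesis by simp
      qed (use \<open>\<alpha> \<in> N\<close> in simp)
    qed
  qed (rule N(1))

  \<comment> \<open>The bounding operation below \<open>a0\<close>\<close>
  have "\<exists>s<a0. \<forall>y\<in>op_closure C (set xs \<union> pred_set \<theta>) \<inter> pred_set a0. y < s" for xs
  proof (rule regular_cardinal_bounded)
    have "set xs \<union> pred_set \<theta> \<lesssim> pred_set \<theta>"
      using Un_lepoll_infinite[OF \<theta>_inf] finite_lepoll_infinite[OF \<theta>_inf] by blast
    then have "op_closure C (set xs \<union> pred_set \<theta>) \<inter> pred_set a0 \<lesssim> pred_set \<theta>"
      using op_closure_lepoll[OF \<theta>_inf C_countable] subset_imp_lepoll lepoll_trans
      by (metis inf_le1)
    also have "pred_set \<theta> \<prec> pred_set a0"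
      using A_infinite(1)[OF a0(1)] a0(2) by (simp add: is_cardinal_def)
    finally show "op_closure C (set xs \<union> pred_set \<theta>) \<inter> pred_set a0 \<prec> pred_set a0" .
  qed (use assms(1) a0(1) in auto)
  then obtain s where s: "\<And>xs. s xs < a0 \<and>
      (\<forall>y\<in>op_closure C (set xs \<union> pred_set \<theta>) \<inter> pred_set a0. y < s xs)"
    by metis
  then have s_less: "\<And>xs. s xs < a0"
    and s_bound: "\<And>xs y. y \<in> op_closure C (set xs \<union> pred_set \<theta>) \<Longrightarrow> y < a0 \<Longrightarrow> y < s xs"
    by (auto simp: pred_set_def)

  \<comment> \<open>\<open>s\<close> bounds closures under \<open>C\<close> alone, so adding it is
    not circular. The operations of \<open>a0\<close> are added without an index argument, since the
    index of \<open>a0\<close> is not yet known to lie in a closed set.\<close>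
  define C' where "C' = insert s (C \<union> range (jop a0))"
  show ?thesis
  proof (rule carries_jonssonI)
    show "countable C'"
      using C_countable by (simp add: C'_def)
    show "closed_under C' (pred_set \<kappa>)"
    proof -
      have "s xs < \<kappa>" for xs
        using s_less[of xs] A_le[OF a0(1)] \<open>\<mu> < \<kappa>\<close> by simp
      then show ?thesis
        using C_closed jop_less[OF a0(1)] by (auto simp: closed_under_def C'_def pred_set_def)
    qed
  next
    fix M assume M: "M \<subseteq> pred_set \<kappa>" "closed_under C' M" "M \<approx> pred_set \<kappa>"
    define N where "N = op_closure C (M \<union> pred_set \<theta>)"
    have "pred_set \<theta> \<subseteq> pred_set \<kappa>"
      using \<open>\<theta> < \<mu>\<close> \<open>\<mu> < \<kappa>\<close> by (auto simp: pred_set_def)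
    then have N_sub: "N \<subseteq> pred_set \<kappa>"
      unfolding N_def using M(1) C_closed by (intro op_closure_least) auto
    have N_sup: "M \<union> pred_set \<theta> \<subseteq> N"
      unfolding N_def by (rule op_closure_superset)
    have \<gamma>_sub: "pred_set \<gamma> \<subseteq> pred_set \<theta>"
      using \<open>\<gamma> \<le> \<theta>\<close> by (auto simp: pred_set_def)
    have "pred_set \<kappa> \<lesssim> N"
      using M(3) N_sup subset_imp_lepoll eqpoll_sym lepoll_trans1 by (metis le_sup_iff)
    then have "N \<approx> pred_set \<kappa>"
      using N_sub subset_imp_lepoll lepoll_antisym by blast
    moreover have "closed_under C N"
      unfolding N_def by (rule closed_under_op_closure)
    moreover have "pred_set \<gamma> \<subseteq> N"
      using N_sup \<gamma>_sub by blast
    ultimately have "pred_set \<mu> \<subseteq> N"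
      by (rule contains_\<mu>[OF N_sub])
    then have a0_sub: "pred_set a0 \<subseteq> N"
      using A_le[OF a0(1)] by (auto simp: pred_set_def)
    have unbM: "unbounded_in (M \<inter> pred_set a0) a0"
      unfolding unbounded_in_def
    proof (intro allI impI)
      fix \<beta> assume "\<beta> < a0"
      then have "\<beta> \<in> op_closure C (M \<union> pred_set \<theta>)"
        using a0_sub by (auto simp: pred_set_def N_def)
      \<comment> \<open>A finite part of \<open>M\<close> together with \<theta> already generates
        \<beta>, so the value of \<open>s\<close> at that part is a point of \<open>M\<close> above
        \<beta>.\<close>
      from op_closure_finitary[OF this]
      obtain xs where "set xs \<subseteq> M" "\<beta> \<in> op_closure C (set xs \<union> pred_set \<theta>)"
        by blast
      then have "s xs \<in> M \<inter> pred_set a0" "\<beta> \<le> s xs"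
        using closed_underD[OF M(2), of s xs] s_less s_bound[of \<beta> xs] \<open>\<beta> < a0\<close>
        by (auto simp: C'_def pred_set_def intro: less_imp_le)
      then show "\<exists>x\<in>M \<inter> pred_set a0. \<beta> \<le> x" ..
    qed
    have jM: "j a0 n xs \<in> M" if "length xs = ar a0 n" "set xs \<subseteq> M \<inter> pred_set a0" for n xs
    proof -
      have "jop a0 n xs \<in> M"
        using that by (intro closed_underD[OF M(2)]) (auto simp: C'_def)
      then show ?thesis
        using that by (simp add: jop_def)
    qed
    have "regular_cardinal a0"
      using assms(1) a0(1) by simp
    then have "pred_set a0 \<subseteq> M"
      using jon[OF a0(1)] unbM jM by (rule jonsson_unbounded_subset)
    \<comment> \<open>Since \<gamma> is below \<open>a0\<close>, all indices are now in
      \<open>M\<close> itself.\<close>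
    then have "pred_set \<gamma> \<subseteq> M"
      using \<open>\<gamma> \<le> \<theta>\<close> a0(2) by (auto simp: pred_set_def subset_iff)
    moreover have "closed_under C M"
      using M(2) by (simp add: closed_under_def C'_def)
    ultimately show "M = pred_set \<kappa>"
      using contains_\<kappa>[OF M(1,3)] by simp
  qed
qed

end
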